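(* Let $(X,d,\mu)$ be a metric measure space. (i) Suppose that for every $x,y\in X$ $$\liminf_{r\to\infty}\frac{\mu(B(x,r)\,\Delta\,B(y,r))}{\mu(B(x,r))}=0.$$ Then every bounded strongly harmonic function in $X$ is constant. (ii) Let $f$ be a bounded weakly harmonic function in $X$ such that for every $x,y\in X$ there exist sequences $(r^x_n)$, $(r^y_n)$ of admissible radii (at $x$ and at $y$, respectively) such that $$\lim_{n\to\infty}\frac{\mu(B(x,r^x_n)\,\Delta\,B(y,r^y_n))}{\mu(B(x,r^x_n))}=0.$$ Then $f$ is constant.
   Context: Standing assumptions: $\mu$ is Borel regular, $0<\mu(B)<\infty$ for every ball $B$, and $X$ is proper (closed bounded sets are compact). $\Delta$ denotes symmetric difference. $A\Subset X$ means that $A$ has compact closure. A locally integrable $f:X\to\mathbb{R}$ is strongly harmonic in $X$ if $f(x)=\frac{1}{\mu(B(x,r))}\int_{B(x,r)}f\,d\mu$ for all $x\in X$, $r>0$ with $B(x,r)\Subset X$. It is weakly harmonic in $X$ if for every $x\in X$ there is a non-empty, at most countable set of positive radii $r^x_i$ (admissible radii at $x$) with $B(x,r^x_i)\Subset X$ and $f(x)=\frac{1}{\mu(B(x,r^x_i))}\int_{B(x,r^x_i)}f\,d\mu$ for all $i$. *)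

theory Defs
  imports "HOL-Analysis.Analysis"
begin

(* The sigma-algebra of M may be larger than the Borel one, e.g. the Caratheodory-measurable
   sets of a Borel regular outer measure. Regularity is stated for measurable A only: for
   arbitrary A, with the outer measure Inf {emeasure M B | A \<subseteq> B, B \<in> sets M}, it then
   follows, since this infimum is attained. *)
locale proper_metric_measure_space =
  fixes M :: "'a::metric_space measure"
  assumes space_M: "space M = UNIV"
    and borel_sets: "sets borel \<subseteq> sets M"
    and borel_regular:
      "A \<in> sets M \<Longrightarrow> \<exists>B \<in> sets borel. A \<subseteq> B \<and> emeasure M B = emeasure M A"
    and ball_pos: "0 < r \<Longrightarrow> 0 < emeasure M (ball x r)"
    and ball_finite: "0 < r \<Longrightarrow> emeasure M (ball x r) < \<infinity>"
    and proper: "closed S \<Longrightarrow> bounded S \<Longrightarrow> compact (S :: 'a set)"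

definition locally_integrable :: "'a::metric_space measure \<Rightarrow> ('a \<Rightarrow> real) \<Rightarrow> bool" where
  "locally_integrable M f \<longleftrightarrow> (\<forall>x. \<exists>r>0. set_integrable M (ball x r) f)"

definition mean_value_at ::
  "'a::metric_space measure \<Rightarrow> ('a \<Rightarrow> real) \<Rightarrow> 'a \<Rightarrow> real \<Rightarrow> bool" where
  "mean_value_at M f x r \<longleftrightarrow>
     f x = 1 / measure M (ball x r) * (LINT y:ball x r|M. f y)"

definition strongly_harmonic :: "'a::metric_space measure \<Rightarrow> ('a \<Rightarrow> real) \<Rightarrow> bool" where
  "strongly_harmonic M f \<longleftrightarrow> locally_integrable M f \<and>
     (\<forall>x r. 0 < r \<and> compact (closure (ball x r)) \<longrightarrow> mean_value_at M f x r)"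

(* R x is the set of radii r^x_i chosen at x. It need not contain every radius at which
   the mean value property happens to hold. *)
definition admissible_radii ::
  "'a::metric_space measure \<Rightarrow> ('a \<Rightarrow> real) \<Rightarrow> ('a \<Rightarrow> real set) \<Rightarrow> bool" where
  "admissible_radii M f R \<longleftrightarrow> (\<forall>x. R x \<noteq> {} \<and> countable (R x) \<and>
     (\<forall>r \<in> R x. 0 < r \<and> compact (closure (ball x r)) \<and> mean_value_at M f x r))"

definition weakly_harmonic :: "'a::metric_space measure \<Rightarrow> ('a \<Rightarrow> real) \<Rightarrow> bool" where
  "weakly_harmonic M f \<longleftrightarrow> locally_integrable M f \<and> (\<exists>R. admissible_radii M f R)"

end

theory Submission
  imports Defs
begin

text \<open>If \<open>\<bar>f\<bar> \<le> K\<close> and \<open>f\<close> has the mean value property on \<open>A = B(x, r)\<close> and \<open>B = B(y, s)\<close>, then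
  \<open>\<mu>(A) (f x - f y) = \<integral>\<^sub>A f - \<integral>\<^sub>B f + (\<mu>(B) - \<mu>(A)) f y\<close>, and both differences on the right are at
  most \<open>K \<mu>(A \<Delta> B)\<close> in absolute value.\<close>

context proper_metric_measure_space
begin

lemma ball_sets [measurable]: "ball x r \<in> sets M"
  using borel_sets by auto

lemma ball_fmeasurable: "ball x r \<in> fmeasurable M"
  by (cases "0 < r") (use ball_finite ball_sets in \<open>auto intro!: fmeasurableI simp: ball_empty\<close>)

text \<open>Finiteness matters as much as positivity here: \<open>measure\<close> sends an infinite
  value to 0.\<close>

lemma measure_ball_pos: "0 < r \<Longrightarrow> 0 < measure M (ball x r)"
  using ball_pos[of r x] fmeasurableD2[OF ball_fmeasurable]
  by (simp add: measure_def enn2real_positive_iff less_top)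

text \<open>Properness makes \<open>cball x r\<close> compact, so finitely many of the small balls
  on which \<open>f\<close> is integrable cover it.\<close>

lemma locally_integrable_on_ball:
  assumes "locally_integrable M f"
  shows "set_integrable M (ball x r) f"
proof -
  obtain \<rho> where \<rho>: "\<And>z. 0 < \<rho> z" "\<And>z. set_integrable M (ball z (\<rho> z)) f"
    using assms unfolding locally_integrable_def by metis
  have K: "compact (cball x r)"
    by (intro proper) auto
  have cov: "cball x r \<subseteq> (\<Union>z\<in>cball x r. ball z (\<rho> z))"
    using \<rho>(1) by auto
  obtain C where C: "finite C" "cball x r \<subseteq> (\<Union>z\<in>C. ball z (\<rho> z))"
    by (rule compactE_image[OF K _ cov]) auto
  have "set_integrable M (\<Union>z\<in>C. ball z (\<rho> z)) f"
    by (intro set_integrable_UN C \<rho>) auto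
  then show ?thesis
    by (rule set_integrable_subset) (use C(2) ball_subset_cball in auto)
qed

text \<open>The two integrands agree on the intersection of the balls and vanish outside their
  union. On the symmetric difference exactly one of them survives, and it is at most
  \<open>K\<close> in absolute value.\<close>

lemma set_integral_diff_le_sym_diff:
  assumes f: "\<And>z. \<bar>f z\<bar> \<le> K" "locally_integrable M f"
  shows "\<bar>(LINT z:ball x r|M. f z) - (LINT z:ball y s|M. f z)\<bar>
           \<le> K * measure M (sym_diff (ball x r) (ball y s))"
proof -
  let ?A = "ball x r" and ?B = "ball y s"
  have int: "integrable M (\<lambda>z. indicator ?A z *\<^sub>R f z)" "integrable M (\<lambda>z. indicator ?B z *\<^sub>R f z)"
    using locally_integrable_on_ball[OF f(2)] unfolding set_integrable_def by blast+
  have D: "sym_diff ?A ?B \<in> fmeasurable M"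
    by (intro fmeasurable.Un fmeasurable_Diff ball_fmeasurable ball_sets)
  have "\<bar>(LINT z:?A|M. f z) - (LINT z:?B|M. f z)\<bar>
      = norm (LINT z|M. indicator ?A z *\<^sub>R f z - indicator ?B z *\<^sub>R f z)"
    unfolding set_lebesgue_integral_def using int by simp
  also have "\<dots> \<le> (LINT z|M. norm (indicator ?A z *\<^sub>R f z - indicator ?B z *\<^sub>R f z))"
    by (rule integral_norm_bound)
  also have "\<dots> \<le> (LINT z|M. K * indicator (sym_diff ?A ?B) z)"
  proof (rule integral_mono)
    show "integrable M (\<lambda>z. K * indicator (sym_diff ?A ?B) z)"
      using D by (intro integrable_mult_right integrable_real_indicator)
        (auto simp: fmeasurable_def)
  qed (use int f(1) in \<open>auto simp: indicator_def\<close>)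
  also have "\<dots> = K * measure M (sym_diff ?A ?B)"
    using space_M by simp
  finally show ?thesis .
qed

text \<open>This is the preceding estimate for the constant function 1, which is locally integrable
  because balls have finite measure.\<close>

lemma measure_ball_diff_le_sym_diff:
  "\<bar>measure M (ball x r) - measure M (ball y s)\<bar> \<le> measure M (sym_diff (ball x r) (ball y s))"
proof -
  have "locally_integrable M (\<lambda>_. 1 :: real)"
    unfolding locally_integrable_def set_integrable_def
    using ball_finite by (auto intro!: exI[of _ 1] integrable_real_indicator)
  from set_integral_diff_le_sym_diff[OF _ this, of 1 x r y s] show ?thesis
    using space_M by (simp add: set_lebesgue_integral_def)
qed

lemma mean_value_diff_le:
  assumes f: "\<And>z. \<bar>f z\<bar> \<le> K" "locally_integrable M f"
    and "0 < r" "0 < s" "mean_value_at M f x r" "mean_value_at M f y s"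
  shows "\<bar>f x - f y\<bar>
           \<le> 2 * K * (measure M (sym_diff (ball x r) (ball y s)) / measure M (ball x r))"
proof -
  let ?a = "measure M (ball x r)" and ?b = "measure M (ball y s)"
  let ?d = "measure M (sym_diff (ball x r) (ball y s))"
  have pos: "0 < ?a" "0 < ?b"
    using assms measure_ball_pos by auto
  have fx: "?a * f x = (LINT z:ball x r|M. f z)"
    using assms(5) pos unfolding mean_value_at_def by simp
  have fy: "?b * f y = (LINT z:ball y s|M. f z)"
    using assms(6) pos unfolding mean_value_at_def by simp
  have "\<bar>(?b - ?a) * f y\<bar> \<le> ?d * K"
    unfolding abs_mult
    using measure_ball_diff_le_sym_diff[of x r y s] f(1)[of y]
    by (intro mult_mono) auto
  moreover have "\<bar>?a * f x - ?b * f y\<bar> \<le> K * ?d"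
    unfolding fx fy by (rule set_integral_diff_le_sym_diff[OF f])
  moreover have "?a * (f x - f y) = (?a * f x - ?b * f y) + (?b - ?a) * f y"
    by (simp add: algebra_simps)
  ultimately have "\<bar>?a * (f x - f y)\<bar> \<le> 2 * K * ?d"
    by (simp add: mult.commute)
  then show ?thesis
    using pos(1) by (simp add: abs_mult pos_le_divide_eq mult.commute)
qed

text \<open>Common core of both claims. The radii may depend on \<open>e\<close> and may differ at
  the two points, so a vanishing lower limit and a limit along chosen sequences both supply
  them.\<close>

lemma constant_if_small_sym_diff:
  assumes "bounded (range f)" "locally_integrable M f"
    and small: "\<And>x y e. 0 < e \<Longrightarrow> \<exists>r s. 0 < r \<and> 0 < s \<and> mean_value_at M f x r \<and> mean_value_at M f y s \<and>
      measure M (sym_diff (ball x r) (ball y s)) / measure M (ball x r) < e"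
  shows "f constant_on UNIV"
proof -
  obtain K where "0 < K" and K: "\<And>z. \<bar>f z\<bar> \<le> K"
    using assms(1) unfolding bounded_pos by auto
  have "f x = f y" for x y
  proof -
    have "\<bar>f x - f y\<bar> \<le> e" if "0 < e" for e
    proof -
      \<comment> \<open>This tolerance cancels the factor \<open>2 * K\<close> in
        \<open>mean_value_diff_le\<close>.\<close>
      have "0 < e / (2 * K)"
        using that \<open>0 < K\<close> by simp
      then obtain r s where rs: "0 < r" "0 < s" "mean_value_at M f x r" "mean_value_at M f y s"
        "measure M (sym_diff (ball x r) (ball y s)) / measure M (ball x r) < e / (2 * K)"
        using small by blast
      have "\<bar>f x - f y\<bar>
          \<le> 2 * K * (measure M (sym_diff (ball x r) (ball y s)) / measure M (ball x r))"
        by (rule mean_value_diff_le[OF K assms(2) rs(1-4)])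
      also have "\<dots> \<le> 2 * K * (e / (2 * K))"
        using rs(5) \<open>0 < K\<close> by (intro mult_left_mono) auto
      finally show ?thesis
        using \<open>0 < K\<close> by simp
    qed
    then show ?thesis
      using field_le_epsilon[of "\<bar>f x - f y\<bar>" 0] by simp
  qed
  then show ?thesis
    unfolding constant_on_def by blast
qed

text \<open>A zero lower limit yields, for each \<open>e\<close>, one radius with quotient below
  \<open>e\<close>; it serves at both points.\<close>

lemma strongly_harmonic_constant:
  assumes lim: "\<And>x y. Liminf at_top (\<lambda>r::real.
      ereal (measure M (sym_diff (ball x r) (ball y r)) / measure M (ball x r))) = 0"
    and f: "bounded (range f)" "strongly_harmonic M f"
  shows "f constant_on UNIV"
proof (rule constant_if_small_sym_diff)
  show "locally_integrable M f"
    using f(2) unfolding strongly_harmonic_def by simp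
  fix x y and e :: real
  assume "0 < e"
  let ?q = "\<lambda>r. measure M (sym_diff (ball x r) (ball y r)) / measure M (ball x r)"
  have "\<exists>r>0. ?q r < e"
  proof (rule ccontr)
    assume "\<not> ?thesis"
    \<comment> \<open>Otherwise the quotient is at least \<open>e\<close> at every positive radius,
      hence eventually, and its lower limit is at least \<open>e\<close>. Nonpositive radii are
      excluded because there the balls are empty and the quotient is 0 / 0 = 0.\<close>
    then have "\<forall>\<^sub>F r in at_top. ereal e \<le> ereal (?q r)"
      by (intro eventually_mono[OF eventually_gt_at_top[of 0]]) (force simp: not_less)
    from Liminf_bounded[OF this] show False
      using lim[of x y] \<open>0 < e\<close> by simp
  qed
  then obtain r where r: "0 < r" "?q r < e"
    by blast
  \<comment> \<open>By properness every ball has compact closure, so strong harmonicity gives the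
    mean value property at the radius just found, whatever the centre.\<close>
  have "compact (closure (ball z r))" for z :: 'a
    by (intro proper) auto
  then have "mean_value_at M f z r" for z
    using f(2) r unfolding strongly_harmonic_def by blast
  then show "\<exists>r s. 0 < r \<and> 0 < s \<and> mean_value_at M f x r \<and> mean_value_at M f y s \<and>
      measure M (sym_diff (ball x r) (ball y s)) / measure M (ball x r) < e"
    using r by blast
qed (fact f)

text \<open>A single index far enough along the two sequences gives the required pair of radii;
  membership in \<open>R\<close> makes them positive and provides the mean value property.\<close>

lemma weakly_harmonic_constant:
  assumes f: "bounded (range f)" "weakly_harmonic M f" and R: "admissible_radii M f R"
    and lim: "\<And>x y. \<exists>rx ry. (\<forall>n::nat. rx n \<in> R x) \<and> (\<forall>n. ry n \<in> R y) \<and>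
      (\<lambda>n. measure M (sym_diff (ball x (rx n)) (ball y (ry n))) / measure M (ball x (rx n)))
        \<longlonglongrightarrow> 0"
  shows "f constant_on UNIV"
proof (rule constant_if_small_sym_diff)
  show "locally_integrable M f"
    using f(2) unfolding weakly_harmonic_def by simp
  fix x y and e :: real
  assume "0 < e"
  obtain rx ry where r: "\<And>n::nat. rx n \<in> R x" "\<And>n. ry n \<in> R y"
    and q: "(\<lambda>n. measure M (sym_diff (ball x (rx n)) (ball y (ry n))) / measure M (ball x (rx n)))
      \<longlonglongrightarrow> 0"
    using lim by blast
  obtain n where n: "measure M (sym_diff (ball x (rx n)) (ball y (ry n))) / measure M (ball x (rx n)) < e"
    using eventually_happens[OF order_tendstoD(2)[OF q \<open>0 < e\<close>]] by auto
  show "\<exists>r s. 0 < r \<and> 0 < s \<and> mean_value_at M f x r \<and> mean_value_at M f y s \<and>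
      measure M (sym_diff (ball x r) (ball y s)) / measure M (ball x r) < e"
    using R r[of n] n unfolding admissible_radii_def by blast
qed (fact f)

end

theorem theorem7p2:
  fixes M :: "'a::metric_space measure"
  assumes "proper_metric_measure_space M"
  shows
    "((\<forall>x y. Liminf at_top (\<lambda>r::real.
         ereal (measure M (sym_diff (ball x r) (ball y r)) / measure M (ball x r))) = 0)
       \<longrightarrow> (\<forall>f. bounded (range f) \<and> strongly_harmonic M f \<longrightarrow> f constant_on UNIV))
     \<and>
     (\<forall>f R. bounded (range f) \<and> weakly_harmonic M f \<and> admissible_radii M f R \<and>
        (\<forall>x y. \<exists>rx ry. (\<forall>n::nat. rx n \<in> R x) \<and> (\<forall>n. ry n \<in> R y) \<and>
           (\<lambda>n. measure M (sym_diff (ball x (rx n)) (ball y (ry n))) / measure M (ball x (rx n)))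
             \<longlonglongrightarrow> 0)
       \<longrightarrow> f constant_on UNIV)"
proof -
  interpret proper_metric_measure_space M
    by (fact assms)
  show ?thesis
    using strongly_harmonic_constant weakly_harmonic_constant by blast
qed

end
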